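(* The following identities hold as formal power series in $q$ with coefficients in $\mathbb{Z}[x,y]$: $$1+\sum_{\lambda\in \mathcal{B}} x^{\sharp(\lambda)} y^{\sharp_{1,2}(\lambda)}q^{|\lambda|} = \sum_{i\ge 0}\sum_{j\ge 0}\frac{x^{i+j}y^jq^{i^2+j^2+i+2j}}{(q^2;q^2)_{i+j}}\begin{bmatrix}i\\ j\end{bmatrix}_{q^2}.$$ Furthermore, $$\sum_{\lambda\in \mathcal{B}_E} x^{\sharp(\lambda)} y^{\sharp_{1,2}(\lambda)}q^{|\lambda|} = \sum_{i\ge 1}\sum_{j\ge 0}\frac{x^{i+j}y^jq^{i^2+j^2+i+2j}}{(q^2;q^2)_{i+j}}\begin{bmatrix}i-1\\ j\end{bmatrix}_{q^2}$$ and $$\sum_{\lambda\in \mathcal{B}_O} x^{\sharp(\lambda)} y^{\sharp_{1,2}(\lambda)}q^{|\lambda|} = \sum_{i\ge 1}\sum_{j\ge 0}\frac{x^{i+j}y^jq^{i^2+j^2+3i}}{(q^2;q^2)_{i+j}}\begin{bmatrix}i-1\\ j-1\end{bmatrix}_{q^2}.$$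
   Context: $\mathcal{B}$ denotes the set of Euclidean billiard partitions: nonempty integer partitions into distinct parts such that (E1) adjacent parts (i.e. consecutive parts when the parts are listed in order of size) are never both odd; (E2) the smallest part is even. $\mathcal{B}_E$ (resp. $\mathcal{B}_O$) is the set of partitions in $\mathcal{B}$ whose largest part is even (resp. odd). For an integer partition $\lambda$: $|\lambda|$ is the sum of its parts, $\sharp(\lambda)$ is the number of its parts, and $\sharp_{a,M}(\lambda)$ is the number of its parts congruent to $a$ modulo $M$; thus $\sharp_{1,2}(\lambda)$ is the number of odd parts. The $q$-Pochhammer symbol is $(A;q)_n=\prod_{k=0}^{n-1}(1-Aq^k)$, and the $q$-binomial coefficient is $\begin{bmatrix}A\\ B\end{bmatrix}_q=\dfrac{(q;q)_A}{(q;q)_B(q;q)_{A-B}}$ if $0\le B\le A$ and $0$ otherwise. The subscript $q^2$ means $q$ is replaced by $q^2$. *)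

theory Defs
  imports
    "HOL-Analysis.Infinite_Sum"
    "HOL-Computational_Algebra.Polynomial"
    "HOL-Computational_Algebra.Formal_Power_Series"
begin

section \<open>Partitions\<close>

definition int_partition :: "nat list \<Rightarrow> bool" where
  "int_partition ps \<longleftrightarrow> sorted_wrt (\<ge>) ps \<and> (\<forall>p\<in>set ps. p > 0)"

text \<open>Parts are listed in weakly decreasing order, so the head of the list is the largest part
  and the last entry is the smallest.\<close>

definition billiard_partitions :: "nat list set" where
  "billiard_partitions =
    {ps. int_partition ps \<and> ps \<noteq> [] \<and> distinct ps \<and>
         (\<forall>k. Suc k < length ps \<longrightarrow> \<not> (odd (ps ! k) \<and> odd (ps ! Suc k))) \<and>
         even (last ps)}"

definition billiard_partitions_even :: "nat list set" where
  "billiard_partitions_even = {ps \<in> billiard_partitions. even (hd ps)}"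

definition billiard_partitions_odd :: "nat list set" where
  "billiard_partitions_odd = {ps \<in> billiard_partitions. odd (hd ps)}"

definition num_parts_cong :: "nat \<Rightarrow> nat \<Rightarrow> nat list \<Rightarrow> nat" where
  "num_parts_cong a M ps = length (filter (\<lambda>p. p mod M = a mod M) ps)"


section \<open>Formal power series in \<open>q\<close> over \<open>\<int>[x,y]\<close>\<close>

text \<open>The coefficient ring \<open>\<int>[x,y]\<close> is rendered as \<open>(\<int>[y])[x]\<close>, that is \<^typ>\<open>int poly poly\<close>.
  The topology on formal power series is the library's \<open>q\<close>-adic one, which does not involve
  any topology on the coefficients.\<close>

type_synonym series = "int poly poly fps"

definition var_q :: series where "var_q = fps_X"
definition var_x :: series where "var_x = fps_const [:0, 1:]"
definition var_y :: series where "var_y = fps_const [:[:0, 1:]:]"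

text \<open>The library's division of power series needs an inverse operation on the coefficients,
  which polynomial rings do not have. All denominators here have constant term 1 and hence are
  units; the following is the quotient in that case.\<close>

definition fps_quot :: "'a::comm_ring_1 fps \<Rightarrow> 'a fps \<Rightarrow> 'a fps" where
  "fps_quot f g = f * fps_right_inverse g 1"

lemma fps_quot_eq_iff:
  assumes "fps_nth g 0 = 1"
  shows "fps_quot f g = h \<longleftrightarrow> f = h * g"
proof -
  have inv: "g * fps_right_inverse g 1 = 1"
    by (rule fps_right_inverse) (simp add: assms)
  show ?thesis
  proof
    assume h: "fps_quot f g = h"
    have "fps_quot f g * g = f * (g * fps_right_inverse g 1)"
      unfolding fps_quot_def by (simp only: mult_ac)
    then show "f = h * g"
      by (simp only: inv mult_1_right h)
  next
    assume "f = h * g"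
    then have "fps_quot f g = h * (g * fps_right_inverse g 1)"
      unfolding fps_quot_def by (simp only: mult_ac)
    then show "fps_quot f g = h"
      by (simp only: inv mult_1_right)
  qed
qed


section \<open>\<open>q\<close>-Pochhammer symbols and \<open>q\<close>-binomial coefficients\<close>

definition qpochhammer :: "'a::comm_ring_1 \<Rightarrow> 'a \<Rightarrow> nat \<Rightarrow> 'a" where
  "qpochhammer A q n = (\<Prod>k<n. 1 - A * q ^ k)"

text \<open>The arguments are integers, since lower index \<open>-1\<close> does occur.\<close>

definition qbinomial :: "'a::comm_ring_1 fps \<Rightarrow> int \<Rightarrow> int \<Rightarrow> 'a fps" where
  "qbinomial q A B =
    (if 0 \<le> B \<and> B \<le> A
     then fps_quot (qpochhammer q q (nat A))
                   (qpochhammer q q (nat B) * qpochhammer q q (nat (A - B)))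
     else 0)"

lemma qpochhammer_nth_0:
  assumes "fps_nth q 0 = 0"
  shows "fps_nth (qpochhammer q q n) 0 = 1"
  by (induction n) (simp_all add: qpochhammer_def assms)


definition partition_weight :: "nat list \<Rightarrow> series" where
  "partition_weight ps =
    var_x ^ length ps * var_y ^ num_parts_cong 1 2 ps * var_q ^ sum_list ps"

end

theory Submission
  imports Defs
begin

text \<open>
  Fix the numbers \<open>i\<close> of even and \<open>j\<close> of odd parts, and let \<open>E\<^sub>i\<^sub>j\<close>, \<open>O\<^sub>i\<^sub>j\<close> count the decreasing lists
  of positive integers without adjacent odd entries whose smallest part is even, respectively odd.
  Either the smallest part exceeds 2 and all parts can be lowered by 2, or it is 2 (remove it and
  lower the others by 2) or 1 (remove it). Hence
  \<open>(1 - q\<^bsup>2(i+j)\<^esup>) E\<^sub>i\<^sub>j = q\<^bsup>2(i+j)\<^esup> (E\<^bsub>i-1,j\<^esub> + O\<^bsub>i-1,j\<^esub>)\<close> and \<open>(1 - q\<^bsup>2(i+j)\<^esup>) O\<^sub>i\<^sub>j = q E\<^bsub>i,j-1\<^esub>\<close>, and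
  the \<open>q\<close>-Pascal rule solves this recurrence. An even largest part only moves the start of
  the recurrence from \<open>i = 0\<close> to \<open>i = 1\<close>; the case of an odd largest part is the difference of
  the other two, by the other \<open>q\<close>-Pascal rule.
\<close>

section \<open>\<open>q\<close>-Pascal rules\<close>

lemma qpochhammer_Suc:
  "qpochhammer A q (Suc n) = (1 - A * q ^ n) * qpochhammer A q n"
  by (simp add: qpochhammer_def)

lemma qpochhammer_nonzero:
  fixes q :: "'a::comm_ring_1 fps"
  assumes "fps_nth q 0 = 0"
  shows "qpochhammer q q n \<noteq> 0"
  using qpochhammer_nth_0[OF assms, of n] by auto

lemma qbinomial_mult:
  assumes "fps_nth q 0 = 0"
  shows "qbinomial q (int (b + d)) (int b) * (qpochhammer q q b * qpochhammer q q d)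
    = qpochhammer q q (b + d)"
  using fps_quot_eq_iff[of "qpochhammer q q b * qpochhammer q q d" "qpochhammer q q (b + d)",
      OF _, of "qbinomial q (int (b + d)) (int b)"]
  by (simp add: qbinomial_def qpochhammer_nth_0[OF assms] nat_int_add)

text \<open>Denominators have constant term 1, so over an integral domain they cancel. Evaluating a
  \<open>q\<close>-binomial thus reduces to checking a product identity free of division.\<close>

lemma qbinomial_unique:
  fixes q :: "'a::idom fps"
  assumes "fps_nth q 0 = 0"
    and "x * (qpochhammer q q b * qpochhammer q q d) = qpochhammer q q (b + d)"
  shows "qbinomial q (int (b + d)) (int b) = x"
  by (metis assms mult_cancel_right mult_eq_0_iff qbinomial_mult qpochhammer_nonzero)

lemma qbinomial_0_right:
  fixes q :: "'a::idom fps"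
  assumes "fps_nth q 0 = 0"
  shows "qbinomial q (int n) 0 = 1"
  using qbinomial_unique[OF assms, of 1 0 n] by (simp add: qpochhammer_def)

lemma qbinomial_self:
  fixes q :: "'a::idom fps"
  assumes "fps_nth q 0 = 0"
  shows "qbinomial q (int n) (int n) = 1"
  using qbinomial_unique[OF assms, of 1 n 0] by (simp add: qpochhammer_def)

lemma qbinomial_eq_0: "b < 0 \<or> a < b \<Longrightarrow> qbinomial q a b = 0"
  by (auto simp: qbinomial_def)

text \<open>With \<open>k = c + 1\<close> and \<open>n = c + 1 + d\<close>, clearing denominators
  leaves two ways of splitting \<open>1 - q^(c+d+2)\<close>: as
  \<open>q^(c+1) * (1 - q^(d+1)) + (1 - q^(c+1))\<close> and as
  \<open>(1 - q^(d+1)) + q^(d+1) * (1 - q^(c+1))\<close>. The first rule solves the recurrence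
  below, the second yields the case of an odd largest part.\<close>

lemma qbinomial_pascal:
  fixes q :: "'a::idom fps"
  assumes q: "fps_nth q 0 = 0"
  shows "qbinomial q (int (Suc n)) (int k)
      = q ^ k * qbinomial q (int n) (int k) + qbinomial q (int n) (int k - 1)"
    and "k \<le> Suc n \<Longrightarrow> qbinomial q (int (Suc n)) (int k)
      = qbinomial q (int n) (int k) + q ^ (Suc n - k) * qbinomial q (int n) (int k - 1)"
proof -
  have "(qbinomial q (int (Suc n)) (int k)
      = q ^ k * qbinomial q (int n) (int k) + qbinomial q (int n) (int k - 1)) \<and>
    (k \<le> Suc n \<longrightarrow> qbinomial q (int (Suc n)) (int k)
      = qbinomial q (int n) (int k) + q ^ (Suc n - k) * qbinomial q (int n) (int k - 1))"
  proof -
    \<comment> \<open>Only for \<open>1 <= k <= n\<close> are all three coefficients proper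
      quotients; in the other cases some are 0 by convention.\<close>
    consider "k = 0" | "k = Suc n" | "k > Suc n"
      | c d where "k = Suc c" "n = Suc c + d"
      by (metis less_imp_Suc_add add_Suc linorder_neqE_nat not0_implies_Suc
          not_less_eq add_Suc_right)
    then show ?thesis
    proof cases
      case 1
      then show ?thesis
        using qbinomial_0_right[OF q, of "Suc n"] qbinomial_0_right[OF q, of n]
        by (simp add: qbinomial_eq_0)
    next
      case 2
      then show ?thesis
        using qbinomial_self[OF q, of "Suc n"] qbinomial_self[OF q, of n]
        by (simp add: qbinomial_eq_0)
    next
      case 3
      then show ?thesis by (simp add: qbinomial_eq_0)
    next
      case 4
      let ?P = "qpochhammer q q"
      have P: "?P (Suc m) = (1 - q ^ Suc m) * ?P m" for m
        by (simp add: qpochhammer_Suc)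
      have e1: "qbinomial q (int n) (int k) * (?P (Suc c) * ?P d) = ?P n"
        using qbinomial_mult[OF q, of "Suc c" d] 4 by simp
      have e2: "qbinomial q (int n) (int k - 1) * (?P c * ?P (Suc d)) = ?P n"
        using qbinomial_mult[OF q, of c "Suc d"] 4 by simp
      \<comment> \<open>The denominator of the left side, \<open>?P (Suc c) * ?P (Suc d)\<close>,
        serves as common denominator; each term on the right lacks one factor of it.\<close>
      have a1: "qbinomial q (int n) (int k) * (?P (Suc c) * ?P (Suc d)) = (1 - q ^ Suc d) * ?P n"
        unfolding e1[symmetric] P[of d] by (simp only: mult_ac)
      have a2: "qbinomial q (int n) (int k - 1) * (?P (Suc c) * ?P (Suc d)) = (1 - q ^ Suc c) * ?P n"
        unfolding e2[symmetric] P[of c] by (simp only: mult_ac)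
      have top: "?P (Suc c + Suc d) = (1 - q ^ Suc c * q ^ Suc d) * ?P n"
        using P[of n] 4 by (simp add: power_add mult_ac)
      have "qbinomial q (int (Suc c + Suc d)) (int (Suc c))
          = q ^ k * qbinomial q (int n) (int k) + qbinomial q (int n) (int k - 1)"
        by (rule qbinomial_unique[OF q])
          (simp only: distrib_right mult.assoc a1 a2 top, simp add: 4 algebra_simps)
      moreover have "qbinomial q (int (Suc c + Suc d)) (int (Suc c))
          = qbinomial q (int n) (int k) + q ^ (Suc n - k) * qbinomial q (int n) (int k - 1)"
        by (rule qbinomial_unique[OF q])
          (simp only: distrib_right mult.assoc a1 a2 top, simp add: 4 algebra_simps)
      ultimately show ?thesis using 4 by simp
    qed
  qed
  then show "qbinomial q (int (Suc n)) (int k)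
      = q ^ k * qbinomial q (int n) (int k) + qbinomial q (int n) (int k - 1)"
    and "k \<le> Suc n \<Longrightarrow> qbinomial q (int (Suc n)) (int k)
      = qbinomial q (int n) (int k) + q ^ (Suc n - k) * qbinomial q (int n) (int k - 1)"
    by blast+
qed


section \<open>Generating functions of sets of lists\<close>

unbundle fps_syntax

text \<open>\<open>card\<close> is 0 on infinite sets, so the coefficients are true counts only if
  each sum is attained finitely often. The recurring condition that 0 is not an entry guarantees
  this.\<close>

definition gf :: "nat list set \<Rightarrow> 'a::comm_ring_1 fps" where
  "gf A = Abs_fps (\<lambda>n. of_nat (card {ps \<in> A. sum_list ps = n}))"

text \<open>Without the entry 0, both the length and every entry are bounded by the sum.\<close>

lemma finite_lists_sum_eq:
  assumes "A \<subseteq> {ps. 0 \<notin> set ps}"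
  shows "finite {ps \<in> A. sum_list ps = (n::nat)}"
proof (rule finite_subset)
  have "length ps \<le> sum_list ps" if "0 \<notin> set ps" for ps :: "nat list"
    using that by (induction ps) auto
  then show "{ps \<in> A. sum_list ps = n} \<subseteq> {ps. set ps \<subseteq> {..n} \<and> length ps \<le> n}"
    using assms member_le_sum_list by fastforce
  show "finite {ps. set ps \<subseteq> {..n} \<and> length ps \<le> n}"
    by (rule finite_lists_length_le) simp
qed

lemma gf_empty [simp]: "gf {} = 0"
  by (simp add: gf_def fps_eq_iff)

lemma gf_singleton: "gf {ps} = fps_X ^ sum_list ps"
proof -
  have "{xs \<in> {ps}. sum_list xs = n} = (if n = sum_list ps then {ps} else {})" for n
    by auto
  then show ?thesis by (simp add: gf_def fps_eq_iff fps_X_power_nth)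
qed

lemma gf_Un_disjoint:
  assumes "A \<subseteq> {ps. 0 \<notin> set ps}" "B \<subseteq> {ps. 0 \<notin> set ps}" "A \<inter> B = {}"
  shows "gf (A \<union> B) = gf A + gf B"
proof (rule fps_ext)
  fix n
  have "{ps \<in> A \<union> B. sum_list ps = n} = {ps \<in> A. sum_list ps = n} \<union> {ps \<in> B. sum_list ps = n}"
    by auto
  moreover have "{ps \<in> A. sum_list ps = n} \<inter> {ps \<in> B. sum_list ps = n} = {}"
    using assms(3) by auto
  ultimately show "gf (A \<union> B) $ n = (gf A + gf B) $ n"
    by (simp add: gf_def card_Un_disjoint finite_lists_sum_eq assms)
qed

lemma gf_image:
  assumes "inj_on f A" "\<And>ps. ps \<in> A \<Longrightarrow> sum_list (f ps) = k + sum_list ps"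
  shows "gf (f ` A) = fps_X ^ k * gf A"
proof (rule fps_ext)
  fix n
  have "{ps \<in> f ` A. sum_list ps = n} = f ` {ps \<in> A. k + sum_list ps = n}"
    using assms(2) by auto
  then have "card {ps \<in> f ` A. sum_list ps = n} = card {ps \<in> A. k + sum_list ps = n}"
    using assms(1) by (simp add: card_image inj_on_def)
  moreover have "{ps \<in> A. k + sum_list ps = n} =
      (if n < k then {} else {ps \<in> A. sum_list ps = n - k})"
    by auto
  ultimately show "gf (f ` A) $ n = (fps_X ^ k * gf A) $ n"
    by (simp add: gf_def fps_X_power_mult_nth)
qed

text \<open>Summation over the fibres of the statistic \<open>K\<close>. In each degree only
  finitely many lists contribute, so both families converge \<open>q\<close>-adically, and grouping
  these lists by \<open>K\<close> shows that the limits agree. Indices in \<open>I\<close> outside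
  the image of \<open>K\<close> contribute 0.\<close>

lemma has_sum_gf:
  fixes c :: "'k \<Rightarrow> 'a::comm_ring_1" and w :: "nat list \<Rightarrow> 'a fps"
  assumes A: "A \<subseteq> {ps. 0 \<notin> set ps}"
    and w: "\<And>ps. ps \<in> A \<Longrightarrow> w ps = fps_const (c (K ps)) * fps_X ^ sum_list ps"
    and I: "K ` A \<subseteq> I"
    and F: "\<And>k. k \<in> I \<Longrightarrow> F k = fps_const (c k) * gf {ps \<in> A. K ps = k}"
  defines "S \<equiv> Abs_fps (\<lambda>n. \<Sum>ps | ps \<in> A \<and> sum_list ps = n. c (K ps))"
  shows "(w has_sum S) A" and "(F has_sum S) I"
proof -
  define L where "L = (\<lambda>n. {ps \<in> A. sum_list ps = n})"
  have fin: "finite (L n)" for n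
    unfolding L_def by (rule finite_lists_sum_eq[OF A])
  have S: "S $ n = (\<Sum>ps\<in>L n. c (K ps))" for n
    by (simp add: S_def L_def)
  have w_nth: "w ps $ n = (if sum_list ps = n then c (K ps) else 0)" if "ps \<in> A" for ps n
    using w[OF that] by (simp add: fps_X_power_nth)
  have sub: "{ps \<in> A. w ps $ n \<noteq> 0} \<subseteq> L n" for n
    by (auto simp: w_nth L_def split: if_splits)
  show "(w has_sum S) A"
  proof (rule has_sum_fpsI)
    fix n
    show "finite {ps \<in> A. w ps $ n \<noteq> 0}"
      using sub fin by (rule finite_subset)
    have "S $ n = (\<Sum>ps\<in>L n. w ps $ n)"
      unfolding S by (rule sum.cong) (auto simp: w_nth L_def)
    also have "\<dots> = (\<Sum>ps | ps \<in> A \<and> w ps $ n \<noteq> 0. w ps $ n)"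
      by (rule sum.mono_neutral_right) (use fin sub in \<open>auto simp: L_def\<close>)
    finally show "S $ n = (\<Sum>ps | ps \<in> A \<and> w ps $ n \<noteq> 0. w ps $ n)" .
  qed
  have F_nth: "F k $ n = (\<Sum>ps | ps \<in> L n \<and> K ps = k. c (K ps))" if "k \<in> I" for k n
  proof -
    have "{ps \<in> {ps \<in> A. K ps = k}. sum_list ps = n} = {ps. ps \<in> L n \<and> K ps = k}"
      by (auto simp: L_def)
    then show ?thesis
      using F[OF that] by (simp add: gf_def mult.commute)
  qed
  \<comment> \<open>Local finiteness of the grouped family: a nonzero coefficient in degree
    \<open>n\<close> forces a list of sum \<open>n\<close> in the fibre over
    \<open>k\<close>.\<close>
  have F_sub: "{k \<in> I. F k $ n \<noteq> 0} \<subseteq> K ` L n" for n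
  proof safe
    fix k assume "k \<in> I" "F k $ n \<noteq> 0"
    then have "{ps. ps \<in> L n \<and> K ps = k} \<noteq> {}"
      using F_nth by (metis sum.empty)
    then show "k \<in> K ` L n" by auto
  qed
  show "(F has_sum S) I"
  proof (rule has_sum_fpsI)
    fix n
    show "finite {k \<in> I. F k $ n \<noteq> 0}"
      using F_sub fin by (meson finite_imageI finite_subset)
    have "S $ n = (\<Sum>k\<in>K ` L n. \<Sum>ps | ps \<in> L n \<and> K ps = k. c (K ps))"
      unfolding S using fin by (rule sum.image_gen)
    also have "\<dots> = (\<Sum>k\<in>K ` L n. F k $ n)"
      by (rule sum.cong) (use I in \<open>auto simp: F_nth L_def\<close>)
    also have "\<dots> = (\<Sum>k | k \<in> I \<and> F k $ n \<noteq> 0. F k $ n)"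
      by (rule sum.mono_neutral_right) (use fin I F_sub in \<open>auto simp: L_def\<close>)
    finally show "S $ n = (\<Sum>k | k \<in> I \<and> F k $ n \<noteq> 0. F k $ n)" .
  qed
qed



section \<open>Decreasing lists without adjacent odd entries\<close>

text \<open>Compared with billiard partitions, the empty list and an odd last entry are allowed, so
  that the class is closed under deleting the last entry. \<open>successively\<close> splits well
  under appending.\<close>

definition billiard_chain :: "nat list \<Rightarrow> bool" where
  "billiard_chain ps \<longleftrightarrow> 0 \<notin> set ps \<and> successively (\<lambda>a b. b < a \<and> (even a \<or> even b)) ps"

lemma billiard_chain_Nil [simp]: "billiard_chain []"
  by (simp add: billiard_chain_def)

lemma billiard_chain_singleton [simp]: "billiard_chain [a] \<longleftrightarrow> 0 < a"
  by (auto simp: billiard_chain_def)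

lemma billiard_chain_snoc:
  "billiard_chain (ps @ [a]) \<longleftrightarrow>
    billiard_chain ps \<and> 0 < a \<and> (ps = [] \<or> a < last ps \<and> (even a \<or> even (last ps)))"
  by (auto simp: billiard_chain_def successively_append_iff)

lemma billiard_chain_snoc_less:
  assumes "billiard_chain (ps @ [a])" "x \<in> set ps"
  shows "a < x"
proof -
  have "successively (>) (ps @ [a])"
    using assms(1) unfolding billiard_chain_def by (auto elim: successively_mono)
  then have "sorted_wrt (>) (ps @ [a])"
    by (simp add: successively_conv_sorted_wrt)
  then show ?thesis
    using assms(2) by (simp add: sorted_wrt_append)
qed

section \<open>Raising all parts by 2\<close>

definition shift2 :: "nat list \<Rightarrow> nat list" where
  "shift2 ps = map (\<lambda>p. p + 2) ps"

lemma shift2_simps [simp]: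
  "length (shift2 ps) = length ps"
  "shift2 ps = [] \<longleftrightarrow> ps = []"
  "ps \<noteq> [] \<Longrightarrow> hd (shift2 ps) = hd ps + 2"
  "ps \<noteq> [] \<Longrightarrow> last (shift2 ps) = last ps + 2"
  "filter even (shift2 ps) = shift2 (filter even ps)"
  "filter odd (shift2 ps) = shift2 (filter odd ps)"
  by (simp_all add: shift2_def hd_map last_map filter_map o_def)

lemma inj_shift2: "inj shift2"
  unfolding shift2_def by (simp add: inj_def inj_map_eq_map)

lemma sum_list_shift2: "sum_list (shift2 ps) = 2 * length ps + sum_list ps"
  by (induction ps) (auto simp: shift2_def)

text \<open>Adding 2 preserves order and parity. The hypothesis matters because an entry 0 would
  become positive.\<close>

lemma billiard_chain_shift2:
  "0 \<notin> set ps \<Longrightarrow> billiard_chain (shift2 ps) \<longleftrightarrow> billiard_chain ps"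
  by (auto simp: billiard_chain_def shift2_def successively_map)

lemma ex_shift2:
  assumes "\<And>x. x \<in> set ps \<Longrightarrow> 2 < x"
  obtains qs where "ps = shift2 qs" "0 \<notin> set qs"
proof
  show "ps = shift2 (map (\<lambda>p. p - 2) ps)"
    using assms by (force simp: shift2_def intro!: map_idI[symmetric])
  show "0 \<notin> set (map (\<lambda>p. p - 2) ps)"
    using assms by force
qed

text \<open>The flag \<open>h\<close> restricts to nonempty lists with even head; \<open>e\<close> prescribes the parity of the
  last entry, the empty list being filed under \<open>e = True\<close>.\<close>

definition chains :: "bool \<Rightarrow> bool \<Rightarrow> nat \<Rightarrow> nat \<Rightarrow> nat list set" where
  "chains h e i j = {ps. billiard_chain ps \<and> (h \<longrightarrow> ps \<noteq> [] \<and> even (hd ps)) \<and>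
     (if e then ps = [] \<or> even (last ps) else ps \<noteq> [] \<and> odd (last ps)) \<and>
     length (filter even ps) = i \<and> length (filter odd ps) = j}"

lemma chains_subset: "chains h e i j \<subseteq> {ps. 0 \<notin> set ps}"
  by (auto simp: chains_def billiard_chain_def)

lemma length_chains: "ps \<in> chains h e i j \<Longrightarrow> length ps = i + j"
  using sum_length_filter_compl[of even ps] by (auto simp: chains_def)

lemma shift2_mem_chains:
  assumes "0 \<notin> set ps"
  shows "shift2 ps \<in> chains h e i j \<longleftrightarrow> ps \<in> chains h e i j"
  using assms by (cases "ps = []") (auto simp: chains_def billiard_chain_shift2)

lemma gf_shift2_chains: "gf (shift2 ` chains h e i j) = (fps_X\<^sup>2) ^ (i + j) * gf (chains h e i j)"
  using gf_image[of shift2 "chains h e i j" "2 * (i + j)"]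
  by (simp add: inj_on_subset[OF inj_shift2] sum_list_shift2 length_chains flip: power_mult)

text \<open>The last entry is either above 2 or equal to 2. In the second case all others exceed 2,
  and what remains after lowering them may end in either parity, since the 2 is even. The extra
  \<open>[]\<close> accounts for the list \<open>[2]\<close>: its remainder is empty, which the flag
  \<open>h\<close> excludes from \<open>chains\<close>.\<close>

lemma chains_even_last:
  "chains h True (Suc i) j = shift2 ` chains h True (Suc i) j \<union>
    (\<lambda>ps. shift2 ps @ [2]) ` (chains h True i j \<union> chains h False i j \<union>
      (if h \<and> i = 0 \<and> j = 0 then {[]} else {}))" (is "?L = ?A \<union> ?f ` ?R")
proof (intro equalityI subsetI)
  fix ps assume ps: "ps \<in> ?L"
  then obtain qs a where qs: "ps = qs @ [a]"
    by (cases ps rule: rev_cases) (auto simp: chains_def)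
  have a: "even a" "a > 0"
    using ps qs by (auto simp: chains_def billiard_chain_snoc)
  have less: "a < x" if "x \<in> set qs" for x
    using ps qs that billiard_chain_snoc_less by (auto simp: chains_def)
  show "ps \<in> ?A \<union> ?f ` ?R"
  proof (cases "a = 2")
    case True
    then obtain rs where rs: "qs = shift2 rs" "0 \<notin> set rs"
      using ex_shift2 less by blast
    have "rs \<in> ?R"
      using ps rs unfolding qs True
      by (cases "rs = []")
        (auto simp: chains_def billiard_chain_snoc billiard_chain_shift2 hd_append split: if_splits)
    then show ?thesis using qs rs True by blast
  next
    case False
    with a have "2 < a" by (cases a; cases "a - 1") auto
    then obtain rs where rs: "ps = shift2 rs" "0 \<notin> set rs"
      using ex_shift2[of ps] less qs by (metis Un_iff empty_iff less_trans set_ConsD set_append list.set(1))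
    then show ?thesis using ps shift2_mem_chains by blast
  qed
next
  fix ps assume "ps \<in> ?A \<union> ?f ` ?R"
  then show "ps \<in> ?L"
  proof
    assume "ps \<in> ?A"
    then show ?thesis
      using shift2_mem_chains chains_subset by blast
  next
    assume "ps \<in> ?f ` ?R"
    then obtain rs where rs: "ps = shift2 rs @ [2]" "rs \<in> ?R" by blast
    then have "0 \<notin> set rs"
      using chains_subset by (fastforce split: if_splits)
    moreover have "0 < last rs" if "rs \<noteq> []"
      using last_in_set[OF that] calculation by (metis gr0I)
    ultimately show ?thesis
      using rs by (cases "rs = []")
        (auto simp: chains_def billiard_chain_snoc billiard_chain_shift2 hd_append split: if_splits)
  qed
qed

lemma chains_odd_last:
  assumes "h \<longrightarrow> 0 < i"
  shows "chains h False i (Suc j) = shift2 ` chains h False i (Suc j) \<union>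
    (\<lambda>ps. ps @ [1]) ` chains h True i j" (is "?L = ?A \<union> ?f ` ?R")
proof (intro equalityI subsetI)
  fix ps assume ps: "ps \<in> ?L"
  then obtain qs a where qs: "ps = qs @ [a]"
    by (cases ps rule: rev_cases) (auto simp: chains_def)
  have a: "odd a"
    using ps qs by (auto simp: chains_def billiard_chain_snoc)
  have less: "a < x" if "x \<in> set qs" for x
    using ps qs that billiard_chain_snoc_less by (auto simp: chains_def)
  show "ps \<in> ?A \<union> ?f ` ?R"
  proof (cases "a = 1")
    case True
    have "qs \<in> ?R"
      using ps assms unfolding qs True
      by (cases "qs = []") (auto simp: chains_def billiard_chain_snoc hd_append split: if_splits)
    then show ?thesis using qs True by blast
  next
    case False
    with a have "2 < a" by (cases a; cases "a - 1"; cases "a - 2") auto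
    then obtain rs where rs: "ps = shift2 rs" "0 \<notin> set rs"
      using ex_shift2[of ps] less qs by (metis Un_iff empty_iff less_trans set_ConsD set_append list.set(1))
    then show ?thesis using ps shift2_mem_chains by blast
  qed
next
  fix ps assume "ps \<in> ?A \<union> ?f ` ?R"
  then show "ps \<in> ?L"
  proof
    assume "ps \<in> ?A"
    then show ?thesis
      using shift2_mem_chains chains_subset by blast
  next
    assume "ps \<in> ?f ` ?R"
    then obtain rs where rs: "ps = rs @ [1]" "rs \<in> ?R" by blast
    then have "0 \<notin> set rs"
      using chains_subset by blast
    \<comment> \<open>The last entry of \<open>rs\<close> is positive and even, hence at least
      2.\<close>
    moreover have "1 < last rs" if "rs \<noteq> []"
      using rs(2) that last_in_set[OF that] \<open>0 \<notin> set rs\<close>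
      by (cases "last rs"; cases "last rs - 1") (auto simp: chains_def)
    ultimately show ?thesis
      using rs by (cases "rs = []") (auto simp: chains_def billiard_chain_snoc hd_append split: if_splits)
  qed
qed

section \<open>Recurrences for the generating functions\<close>

text \<open>The shifted copy is moved to the left side, giving the factor
  \<open>1 - (fps_X^2)^(Suc i + j)\<close>. Raising \<open>i + j\<close> parts by 2 and appending a
  2 adds \<open>2 * (Suc i + j)\<close> to the sum, whence the same power on the right.\<close>

lemma gf_chains_even_last:
  "gf (chains h True (Suc i) j) * (1 - (fps_X\<^sup>2) ^ (Suc i + j)) =
    (fps_X\<^sup>2) ^ (Suc i + j) * (gf (chains h True i j) + gf (chains h False i j) +
      (if h \<and> i = 0 \<and> j = 0 then 1 else 0))"
proof -
  let ?E = "if h \<and> i = 0 \<and> j = 0 then {[]} else {} :: nat list set"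
  let ?R = "chains h True i j \<union> chains h False i j \<union> ?E"
  let ?f = "\<lambda>ps. shift2 ps @ [2]"
  have pos: "?R \<subseteq> {ps. 0 \<notin> set ps}"
    using chains_subset by auto
  have E: "gf ?E = (if h \<and> i = 0 \<and> j = 0 then 1 else 0)"
    by (simp add: gf_singleton)
  have len: "length ps = i + j" if "ps \<in> ?R" for ps
    using that by (auto dest: length_chains split: if_splits)
  have disj: "chains h True i j \<inter> chains h False i j = {}"
    "(chains h True i j \<union> chains h False i j) \<inter> ?E = {}"
    by (auto simp: chains_def)
  have R: "gf ?R = gf (chains h True i j) + gf (chains h False i j) +
      (if h \<and> i = 0 \<and> j = 0 then 1 else 0)"
    using disj chains_subset[of h]
    by (subst gf_Un_disjoint, (auto simp: chains_subset)[3],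
        subst gf_Un_disjoint, simp_all only: E chains_subset)
  have f: "gf (?f ` ?R) = fps_X ^ (2 * (Suc i + j)) * gf ?R"
    by (rule gf_image) (use inj_shift2 len in \<open>auto simp: inj_def inj_on_def sum_list_shift2\<close>)
  \<comment> \<open>The two pieces are told apart by their last entry.\<close>
  have "2 < last ps" if mem: "ps \<in> shift2 ` chains h True (Suc i) j" for ps
  proof -
    obtain rs where rs: "ps = shift2 rs" "rs \<in> chains h True (Suc i) j" using mem by blast
    moreover from rs have "rs \<noteq> []" by (auto simp: chains_def)
    moreover from rs have "0 \<notin> set rs" using chains_subset by blast
    ultimately show ?thesis using rs(1) last_in_set[of rs] by (metis gr0I less_add_same_cancel2 shift2_simps(4))
  qed
  then have "shift2 ` chains h True (Suc i) j \<inter> ?f ` ?R = {}"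
    by fastforce
  moreover have "?f ` ?R \<subseteq> {ps. 0 \<notin> set ps}"
    by (auto simp: shift2_def)
  moreover have "shift2 ` chains h True (Suc i) j \<subseteq> {ps. 0 \<notin> set ps}"
    by (auto simp: shift2_def)
  ultimately have "gf (chains h True (Suc i) j) =
      gf (shift2 ` chains h True (Suc i) j) + gf (?f ` ?R)"
    by (metis (no_types, lifting) chains_even_last gf_Un_disjoint)
  then show ?thesis
    unfolding f R gf_shift2_chains power_mult by (simp add: algebra_simps)
qed

lemma gf_chains_odd_last:
  assumes "h \<longrightarrow> 0 < i"
  shows "gf (chains h False i (Suc j)) * (1 - (fps_X\<^sup>2) ^ (i + Suc j)) = fps_X * gf (chains h True i j)"
proof -
  let ?f = "\<lambda>ps. ps @ [1::nat]"
  have f: "gf (?f ` chains h True i j) = fps_X ^ 1 * gf (chains h True i j)"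
    by (rule gf_image) (auto simp: inj_on_def)
  have "1 < last ps" if "ps \<in> shift2 ` chains h False i (Suc j)" for ps
    using that by (auto simp: chains_def)
  then have "shift2 ` chains h False i (Suc j) \<inter> ?f ` chains h True i j = {}"
    by fastforce
  moreover have "?f ` chains h True i j \<subseteq> {ps. 0 \<notin> set ps}"
    by (auto dest: subsetD[OF chains_subset])
  moreover have "shift2 ` chains h False i (Suc j) \<subseteq> {ps. 0 \<notin> set ps}"
    by (auto simp: shift2_def)
  ultimately have "gf (chains h False i (Suc j)) =
      gf (shift2 ` chains h False i (Suc j)) + gf (?f ` chains h True i j)"
    by (metis (no_types, lifting) assms chains_odd_last gf_Un_disjoint)
  then show ?thesis
    unfolding f gf_shift2_chains by (simp add: algebra_simps)
qed

section \<open>Solution of the recurrence\<close>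

text \<open>Within row \<open>i\<close> the values of \<open>o'\<close> come from \<open>e\<close>
  at \<open>j - 1\<close>, and the resulting powers of \<open>q\<close> for \<open>e\<close> and
  \<open>o'\<close> differ by exactly \<open>(q^2)^j\<close>, the coefficient in the first Pascal
  rule for base \<open>q^2\<close>. The free starting row \<open>m\<close> covers both all chains
  (\<open>m = 0\<close>) and even heads (\<open>m = 1\<close>).\<close>

lemma billiard_recurrence_solution:
  fixes e o' :: "nat \<Rightarrow> nat \<Rightarrow> 'a::idom fps" and q :: "'a fps"
  assumes q: "q = fps_X"
    and base: "\<And>j. e m j * qpochhammer (q\<^sup>2) (q\<^sup>2) (m + j) = (if j = 0 then q ^ (m\<^sup>2 + m) else 0)"
    and e: "\<And>i j. m \<le> i \<Longrightarrow>
      e (Suc i) j * (1 - (q\<^sup>2) ^ (Suc i + j)) = (q\<^sup>2) ^ (Suc i + j) * (e i j + o' i j)"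
    and o0: "\<And>i. o' i 0 = 0"
    and o: "\<And>i j. m \<le> i \<Longrightarrow> o' i (Suc j) * (1 - (q\<^sup>2) ^ (i + Suc j)) = q * e i j"
  shows "e (m + k) j * qpochhammer (q\<^sup>2) (q\<^sup>2) (m + k + j) =
    q ^ ((m + k)\<^sup>2 + j\<^sup>2 + (m + k) + 2 * j) * qbinomial (q\<^sup>2) (int k) (int j)"
proof (induction k arbitrary: j)
  case 0
  have "qbinomial (q\<^sup>2) 0 (int j) = (if j = 0 then 1 else 0)"
    using qbinomial_0_right[of "q\<^sup>2" 0] by (auto simp: q qbinomial_eq_0)
  then show ?case using base[of j] by simp
next
  case (Suc k)
  let ?P = "qpochhammer (q\<^sup>2) (q\<^sup>2)"
  define i where "i = m + k"
  have q0: "q\<^sup>2 $ 0 = 0" by (simp add: q)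
  have P: "?P (Suc n) = (1 - (q\<^sup>2) ^ Suc n) * ?P n" for n
    by (simp add: qpochhammer_Suc)
  have IH: "e i j * ?P (i + j) = q ^ (i\<^sup>2 + j\<^sup>2 + i + 2 * j) * qbinomial (q\<^sup>2) (int k) (int j)" for j
    using Suc.IH by (simp add: i_def)
  \<comment> \<open>For \<open>j = l + 1\<close> the exponent simplifies through
    \<open>l^2 + 2*l + 1 = j^2\<close>. For \<open>j = 0\<close> the lower index is -1, and the
    convention 0 matches \<open>o0\<close>.\<close>
  have O: "o' i j * ?P (i + j) = q ^ (i\<^sup>2 + j\<^sup>2 + i) * qbinomial (q\<^sup>2) (int k) (int j - 1)"
  proof (cases j)
    case 0
    then show ?thesis by (simp add: o0 qbinomial_eq_0)
  next
    case (Suc l)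
    have "o' i j * ?P (i + j) = (o' i (Suc l) * (1 - (q\<^sup>2) ^ (i + Suc l))) * ?P (i + l)"
      unfolding Suc add_Suc_right P by (simp only: mult_ac)
    also have "\<dots> = q * (e i l * ?P (i + l))"
      by (subst o) (simp_all add: i_def mult_ac)
    also have "\<dots> = q ^ Suc (i\<^sup>2 + l\<^sup>2 + i + 2 * l) * qbinomial (q\<^sup>2) (int k) (int l)"
      unfolding IH by (simp add: mult_ac)
    also have "Suc (i\<^sup>2 + l\<^sup>2 + i + 2 * l) = i\<^sup>2 + j\<^sup>2 + i"
      by (simp add: Suc power2_eq_square)
    finally show ?thesis by (simp add: Suc)
  qed
  have "e (Suc i) j * ?P (Suc i + j) = (e (Suc i) j * (1 - (q\<^sup>2) ^ (Suc i + j))) * ?P (i + j)"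
    unfolding add_Suc P by (simp only: mult_ac)
  also have "\<dots> = (q\<^sup>2) ^ (Suc i + j) * (e i j * ?P (i + j) + o' i j * ?P (i + j))"
    by (subst e) (simp_all add: i_def algebra_simps)
  also have "\<dots> = q ^ (2 * (Suc i + j) + (i\<^sup>2 + j\<^sup>2 + i)) *
      ((q\<^sup>2) ^ j * qbinomial (q\<^sup>2) (int k) (int j) + qbinomial (q\<^sup>2) (int k) (int j - 1))"
    unfolding IH O power_add power_mult by (simp only: distrib_left distrib_right mult_ac)
  also have "\<dots> = q ^ (2 * (Suc i + j) + (i\<^sup>2 + j\<^sup>2 + i)) * qbinomial (q\<^sup>2) (int (Suc k)) (int j)"
    unfolding qbinomial_pascal(1)[OF q0] ..
  also have "2 * (Suc i + j) + (i\<^sup>2 + j\<^sup>2 + i) = (Suc i)\<^sup>2 + j\<^sup>2 + Suc i + 2 * j"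
    by (simp add: power2_eq_square)
  finally show ?case by (simp add: i_def)
qed


lemma chains_odd_last_0 [simp]: "chains h False i 0 = {}"
  by (auto simp: chains_def filter_empty_conv)

lemma chains_even_head_0 [simp]: "chains True e 0 j = {}"
  by (auto simp: chains_def filter_empty_conv)

lemma chains_even_last_0: "chains False True 0 j = (if j = 0 then {[]} else {})"
  by (auto simp: chains_def filter_empty_conv)

lemma gf_chains_all:
  "gf (chains False True i j) * qpochhammer (fps_X\<^sup>2) (fps_X\<^sup>2) (i + j) =
    fps_X ^ (i\<^sup>2 + j\<^sup>2 + i + 2 * j) * (qbinomial (fps_X\<^sup>2) (int i) (int j) :: 'a::idom fps)"
proof -
  have "gf (chains False True (0 + i) j) * qpochhammer (fps_X\<^sup>2) (fps_X\<^sup>2) (0 + i + j) =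
    fps_X ^ ((0 + i)\<^sup>2 + j\<^sup>2 + (0 + i) + 2 * j) * (qbinomial (fps_X\<^sup>2) (int i) (int j) :: 'a fps)"
  proof (rule billiard_recurrence_solution[where o' = "\<lambda>i j. gf (chains False False i j)"])
    show "gf (chains False True 0 j) * qpochhammer (fps_X\<^sup>2) (fps_X\<^sup>2) (0 + j) =
        (if j = 0 then fps_X ^ (0\<^sup>2 + 0) else 0 :: 'a fps)" for j
      by (simp add: chains_even_last_0 gf_singleton qpochhammer_def)
    show "gf (chains False True (Suc i) j) * (1 - (fps_X\<^sup>2) ^ (Suc i + j)) =
        (fps_X\<^sup>2) ^ (Suc i + j) * (gf (chains False True i j) + gf (chains False False i j) :: 'a fps)"
      for i j
      unfolding gf_chains_even_last by simp
    show "gf (chains False False i (Suc j)) * (1 - (fps_X\<^sup>2) ^ (i + Suc j)) =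
        fps_X * (gf (chains False True i j) :: 'a fps)" for i j
      by (rule gf_chains_odd_last) simp
  qed simp_all
  then show ?thesis by simp
qed

text \<open>Row 0 is empty, so row 1 is fed only by the correction term for \<open>[2]\<close>,
  which is present just for \<open>j = 0\<close>. Starting in row 1 rather than 0 lowers the upper
  index of the \<open>q\<close>-binomial by one.\<close>

lemma gf_chains_even_head:
  "gf (chains True True (Suc k) j) * qpochhammer (fps_X\<^sup>2) (fps_X\<^sup>2) (Suc k + j) =
    fps_X ^ ((Suc k)\<^sup>2 + j\<^sup>2 + Suc k + 2 * j) * (qbinomial (fps_X\<^sup>2) (int k) (int j) :: 'a::idom fps)"
proof -
  have base: "gf (chains True True 1 j) * qpochhammer (fps_X\<^sup>2) (fps_X\<^sup>2) (1 + j) =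
      (if j = 0 then fps_X ^ (1\<^sup>2 + 1) else 0 :: 'a fps)" for j
  proof -
    have "gf (chains True True 1 j) * qpochhammer (fps_X\<^sup>2) (fps_X\<^sup>2) (1 + j) =
        gf (chains True True (Suc 0) j) * (1 - (fps_X\<^sup>2) ^ (Suc 0 + j)) *
          (qpochhammer (fps_X\<^sup>2) (fps_X\<^sup>2) j :: 'a fps)"
      by (simp only: One_nat_def add_Suc add_0 qpochhammer_Suc power_Suc mult.assoc)
    also have "\<dots> = (fps_X\<^sup>2) ^ Suc j * (if j = 0 then 1 else 0) * qpochhammer (fps_X\<^sup>2) (fps_X\<^sup>2) j"
      unfolding gf_chains_even_last by simp
    also have "\<dots> = (if j = 0 then fps_X ^ (1\<^sup>2 + 1) else 0)"
      by (simp add: qpochhammer_def power2_eq_square)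
    finally show ?thesis .
  qed
  have "gf (chains True True (1 + k) j) * qpochhammer (fps_X\<^sup>2) (fps_X\<^sup>2) (1 + k + j) =
    fps_X ^ ((1 + k)\<^sup>2 + j\<^sup>2 + (1 + k) + 2 * j) * (qbinomial (fps_X\<^sup>2) (int k) (int j) :: 'a fps)"
  proof (rule billiard_recurrence_solution[where o' = "\<lambda>i j. gf (chains True False i j)"])
    show "gf (chains True True 1 j) * qpochhammer (fps_X\<^sup>2) (fps_X\<^sup>2) (1 + j) =
        (if j = 0 then fps_X ^ (1\<^sup>2 + 1) else 0 :: 'a fps)" for j
      by (rule base)
    show "gf (chains True True (Suc i) j) * (1 - (fps_X\<^sup>2) ^ (Suc i + j)) =
        (fps_X\<^sup>2) ^ (Suc i + j) * (gf (chains True True i j) + gf (chains True False i j) :: 'a fps)"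
      if "1 \<le> i" for i j
      using that unfolding gf_chains_even_last by simp
    show "gf (chains True False i (Suc j)) * (1 - (fps_X\<^sup>2) ^ (i + Suc j)) =
        fps_X * (gf (chains True True i j) :: 'a fps)" if "1 \<le> i" for i j
      using that by (intro gf_chains_odd_last) simp
  qed simp_all
  then show ?thesis by simp
qed


section \<open>Billiard partitions\<close>

lemma strict_decreasing_iff:
  "sorted_wrt (>) ps \<longleftrightarrow> sorted_wrt (\<ge>) ps \<and> distinct (ps :: nat list)"
  by (induction ps) (auto simp: order.strict_iff_order)

lemma insert_Nil_billiard_partitions:
  "insert [] billiard_partitions = {ps. billiard_chain ps \<and> (ps = [] \<or> even (last ps))}"
proof -
  have "billiard_chain ps \<longleftrightarrow> int_partition ps \<and> distinct ps \<and>
      (\<forall>k. Suc k < length ps \<longrightarrow> \<not> (odd (ps ! k) \<and> odd (ps ! Suc k)))" for ps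
  proof -
    have "successively (>) ps \<longleftrightarrow> sorted_wrt (\<ge>) ps \<and> distinct ps"
      by (simp add: successively_conv_sorted_wrt strict_decreasing_iff)
    moreover have "0 \<notin> set ps \<longleftrightarrow> (\<forall>p\<in>set ps. 0 < p)"
      by (metis gr0I less_irrefl)
    ultimately show ?thesis
      unfolding billiard_chain_def int_partition_def successively_conv_nth by blast
  qed
  then show ?thesis
    by (auto simp: billiard_partitions_def int_partition_def)
qed

section \<open>Weighted sums over partitions\<close>

definition stats :: "nat list \<Rightarrow> nat \<times> nat" where
  "stats ps = (length (filter even ps), length (filter odd ps))"

definition monomial_xy :: "nat \<times> nat \<Rightarrow> int poly poly" where
  "monomial_xy = (\<lambda>(i, j). [:0, 1:] ^ (i + j) * [:[:0, 1:]:] ^ j)"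

text \<open>Defined coefficientwise, without reference to convergence, as the common limit of the
  sum over partitions and the double sum.\<close>

definition weight_sum :: "nat list set \<Rightarrow> series" where
  "weight_sum A = Abs_fps (\<lambda>n. \<Sum>ps | ps \<in> A \<and> sum_list ps = n. monomial_xy (stats ps))"

lemma partition_weight_eq:
  "partition_weight ps = fps_const (monomial_xy (stats ps)) * fps_X ^ sum_list ps"
proof -
  have "num_parts_cong 1 2 ps = length (filter odd ps)"
    by (simp add: num_parts_cong_def odd_iff_mod_2_eq_one)
  moreover have "length (filter even ps) + length (filter odd ps) = length ps"
    by (simp add: sum_length_filter_compl)
  ultimately show ?thesis
    by (simp add: partition_weight_def monomial_xy_def stats_def var_x_def var_y_def var_q_def
        fps_const_power)
qed

text \<open>Serves all three double sums, with exponent \<open>N\<close> and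
  \<open>q\<close>-binomial \<open>b\<close>. Cancelling the Pochhammer symbol identifies each
  summand with a monomial times the generating function of a fibre of \<open>stats\<close>, so
  \<open>has_sum_gf\<close> applies.\<close>

lemma has_sum_partition_weight:
  assumes A: "A \<subseteq> {ps. 0 \<notin> set ps}" and I: "stats ` A \<subseteq> I"
    and gf: "\<And>i j. (i, j) \<in> I \<Longrightarrow>
      gf {ps \<in> A. stats ps = (i, j)} * qpochhammer (var_q\<^sup>2) (var_q\<^sup>2) (i + j) =
        var_q ^ N i j * b i j"
  shows "(partition_weight has_sum weight_sum A) A"
    and "((\<lambda>(i, j). fps_quot (var_x ^ (i + j) * var_y ^ j * var_q ^ N i j)
      (qpochhammer (var_q\<^sup>2) (var_q\<^sup>2) (i + j)) * b i j) has_sum weight_sum A) I"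
proof -
  let ?F = "\<lambda>(i, j). fps_quot (var_x ^ (i + j) * var_y ^ j * var_q ^ N i j)
      (qpochhammer (var_q\<^sup>2) (var_q\<^sup>2) (i + j)) * b i j"
  have F: "?F k = fps_const (monomial_xy k) * gf {ps \<in> A. stats ps = k}" if "k \<in> I" for k
  proof -
    obtain i j where k: "k = (i, j)" by fastforce
    define P where "P = qpochhammer (var_q\<^sup>2) (var_q\<^sup>2) (i + j)"
    define f where "f = var_x ^ (i + j) * var_y ^ j * var_q ^ N i j"
    have q0: "var_q\<^sup>2 $ 0 = 0" by (simp add: var_q_def)
    have "fps_quot f P * P = f"
      using fps_quot_eq_iff[of P f "fps_quot f P"] qpochhammer_nth_0[OF q0] by (simp add: P_def)
    then have "fps_quot f P * b i j * P = f * b i j"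
      by (metis mult.assoc mult.commute)
    also have "\<dots> = var_x ^ (i + j) * var_y ^ j * gf {ps \<in> A. stats ps = (i, j)} * P"
      using gf[of i j] that by (simp add: k f_def P_def mult.assoc)
    finally have "fps_quot f P * b i j = var_x ^ (i + j) * var_y ^ j * gf {ps \<in> A. stats ps = (i, j)}"
      using qpochhammer_nonzero[OF q0] by (simp add: P_def)
    then show ?thesis
      by (simp add: k f_def P_def monomial_xy_def var_x_def var_y_def fps_const_power)
  qed
  show "(partition_weight has_sum weight_sum A) A"
    unfolding weight_sum_def using has_sum_gf(1)[where K = stats and c = monomial_xy, OF A partition_weight_eq I F] .
  show "(?F has_sum weight_sum A) I"
    unfolding weight_sum_def using has_sum_gf(2)[where K = stats and c = monomial_xy, OF A partition_weight_eq I F] .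
qed

lemma weight_sum_insert_Nil:
  assumes "A \<subseteq> {ps. 0 \<notin> set ps}" "[] \<notin> A"
  shows "weight_sum (insert [] A) = 1 + weight_sum A"
proof (rule fps_ext)
  fix n
  define L where "L = {ps \<in> A. sum_list ps = n}"
  have "{ps. ps \<in> insert [] A \<and> sum_list ps = n} = (if n = 0 then insert [] L else L)"
    by (auto simp: L_def)
  moreover have "finite L" "[] \<notin> L"
    using finite_lists_sum_eq[OF assms(1)] assms(2) by (auto simp: L_def)
  ultimately show "weight_sum (insert [] A) $ n = (1 + weight_sum A) $ n"
    by (simp add: weight_sum_def monomial_xy_def stats_def flip: L_def)
qed

theorem theorem1p2:
  shows
    "(partition_weight summable_on billiard_partitions \<and>
      ((\<lambda>(i, j).
          fps_quot (var_x ^ (i + j) * var_y ^ j * var_q ^ (i^2 + j^2 + i + 2 * j))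
                   (qpochhammer (var_q^2) (var_q^2) (i + j))
          * qbinomial (var_q^2) (int i) (int j))
        has_sum (1 + (\<Sum>\<^sub>\<infinity>ps\<in>billiard_partitions. partition_weight ps)))
       {(i, j). i \<ge> 0 \<and> j \<ge> 0})
     \<and>
     (partition_weight summable_on billiard_partitions_even \<and>
      ((\<lambda>(i, j).
          fps_quot (var_x ^ (i + j) * var_y ^ j * var_q ^ (i^2 + j^2 + i + 2 * j))
                   (qpochhammer (var_q^2) (var_q^2) (i + j))
          * qbinomial (var_q^2) (int i - 1) (int j))
        has_sum (\<Sum>\<^sub>\<infinity>ps\<in>billiard_partitions_even. partition_weight ps))
       {(i, j). i \<ge> 1 \<and> j \<ge> 0})
     \<and>
     (partition_weight summable_on billiard_partitions_odd \<and>
      ((\<lambda>(i, j).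
          fps_quot (var_x ^ (i + j) * var_y ^ j * var_q ^ (i^2 + j^2 + 3 * i))
                   (qpochhammer (var_q^2) (var_q^2) (i + j))
          * qbinomial (var_q^2) (int i - 1) (int j - 1))
        has_sum (\<Sum>\<^sub>\<infinity>ps\<in>billiard_partitions_odd. partition_weight ps))
       {(i, j). i \<ge> 1 \<and> j \<ge> 0})"
proof -
  let ?B = billiard_partitions and ?E = billiard_partitions_even and ?O = billiard_partitions_odd
  let ?P = "qpochhammer (var_q\<^sup>2) (var_q\<^sup>2)"
  have q0: "var_q\<^sup>2 $ 0 = 0" by (simp add: var_q_def)
  have B_iff: "ps \<in> ?B \<longleftrightarrow> billiard_chain ps \<and> ps \<noteq> [] \<and> even (last ps)" for ps
    using insert_Nil_billiard_partitions by (auto simp: set_eq_iff billiard_partitions_def)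
  have pos: "insert [] ?B \<subseteq> {ps. 0 \<notin> set ps}" "?E \<subseteq> {ps. 0 \<notin> set ps}" "?O \<subseteq> {ps. 0 \<notin> set ps}"
    by (auto simp: B_iff billiard_partitions_even_def billiard_partitions_odd_def billiard_chain_def)
  \<comment> \<open>The smallest part is even; hence the last two double sums may start at
    \<open>i = 1\<close>.\<close>
  have even_pos: "1 \<le> length (filter even ps)" if "ps \<in> ?B" for ps
  proof -
    have "last ps \<in> set (filter even ps)"
      using that by (simp add: B_iff)
    then show ?thesis
      by (metis One_nat_def Suc_le_eq length_pos_if_in_set)
  qed
  have I: "stats ` ?E \<subseteq> {(i, j). i \<ge> 1 \<and> j \<ge> 0}" "stats ` ?O \<subseteq> {(i, j). i \<ge> 1 \<and> j \<ge> 0}"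
    using even_pos
    by (auto simp: billiard_partitions_even_def billiard_partitions_odd_def stats_def)
  have B_stats: "{ps \<in> insert [] ?B. stats ps = (i, j)} = chains False True i j" for i j
    unfolding insert_Nil_billiard_partitions by (auto simp: chains_def stats_def)
  have E_stats: "{ps \<in> ?E. stats ps = (i, j)} = chains True True i j" for i j
    by (auto simp: B_iff billiard_partitions_even_def chains_def stats_def)
  have gfE: "gf {ps \<in> ?E. stats ps = (i, j)} * ?P (i + j) =
      var_q ^ (i\<^sup>2 + j\<^sup>2 + i + 2 * j) * qbinomial (var_q\<^sup>2) (int i - 1) (int j)"
    if "(i, j) \<in> {(i, j). i \<ge> 1 \<and> j \<ge> 0}" for i j
    using that gf_chains_even_head[of "i - 1" j]
    by (simp add: E_stats var_q_def of_nat_diff)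
  have gfB: "gf {ps \<in> insert [] ?B. stats ps = (i, j)} * ?P (i + j) =
      var_q ^ (i\<^sup>2 + j\<^sup>2 + i + 2 * j) * qbinomial (var_q\<^sup>2) (int i) (int j)" for i j
    unfolding B_stats using gf_chains_all[of i j] by (simp add: var_q_def)
  have gfO: "gf {ps \<in> ?O. stats ps = (i, j)} * ?P (i + j) =
      var_q ^ (i\<^sup>2 + j\<^sup>2 + 3 * i) * qbinomial (var_q\<^sup>2) (int i - 1) (int j - 1)"
    if "(i, j) \<in> {(i, j). i \<ge> 1 \<and> j \<ge> 0}" for i j
  proof -
    obtain k where k: "i = Suc k" using \<open>(i, j) \<in> _\<close> by (cases i) auto
    \<comment> \<open>Since \<open>i\<close> is positive, the empty list is not in this fibre, and
      every remaining list has an even or an odd head.\<close>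
    have split: "{ps \<in> insert [] ?B. stats ps = (i, j)} =
        {ps \<in> ?E. stats ps = (i, j)} \<union> {ps \<in> ?O. stats ps = (i, j)}"
      by (auto simp: k stats_def billiard_partitions_even_def billiard_partitions_odd_def)
    have "gf {ps \<in> insert [] ?B. stats ps = (i, j)} =
        gf {ps \<in> ?E. stats ps = (i, j)} + (gf {ps \<in> ?O. stats ps = (i, j)} :: series)"
      unfolding split using pos
      by (intro gf_Un_disjoint) (auto simp: billiard_partitions_even_def billiard_partitions_odd_def)
    then have "gf {ps \<in> ?O. stats ps = (i, j)} * ?P (i + j) =
        gf {ps \<in> insert [] ?B. stats ps = (i, j)} * ?P (i + j) -
        gf {ps \<in> ?E. stats ps = (i, j)} * ?P (i + j)"
      by (simp add: algebra_simps)
    also have "\<dots> = var_q ^ (i\<^sup>2 + j\<^sup>2 + i + 2 * j) *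
        (qbinomial (var_q\<^sup>2) (int (Suc k)) (int j) - qbinomial (var_q\<^sup>2) (int k) (int j))"
      unfolding gfB gfE[OF that] by (simp add: k right_diff_distrib)
    also have "\<dots> = var_q ^ (i\<^sup>2 + j\<^sup>2 + 3 * i) * qbinomial (var_q\<^sup>2) (int i - 1) (int j - 1)"
    \<comment> \<open>For \<open>j <= i\<close> the second Pascal rule supplies the factor
      \<open>(q^2)^(i-j)\<close>, which turns \<open>i + 2*j\<close> in the exponent into
      \<open>3*i\<close>. For \<open>j > i\<close> all three \<open>q\<close>-binomials
      vanish.\<close>
    proof (cases "j \<le> i")
      case True
      then have "i\<^sup>2 + j\<^sup>2 + 3 * i = (i\<^sup>2 + j\<^sup>2 + i + 2 * j) + 2 * (Suc k - j)"
        by (simp add: k)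
      moreover have "qbinomial (var_q\<^sup>2) (int (Suc k)) (int j) - qbinomial (var_q\<^sup>2) (int k) (int j) =
          (var_q\<^sup>2) ^ (Suc k - j) * qbinomial (var_q\<^sup>2) (int k) (int j - 1)"
        using qbinomial_pascal(2)[OF q0, of j k] True k by simp
      ultimately show ?thesis
        by (simp only: power_add power_mult mult.assoc) (simp add: k)
    next
      case False
      then show ?thesis by (simp add: k qbinomial_eq_0)
    qed
    finally show ?thesis .
  qed
  \<comment> \<open>The infinite sum in the first identity omits \<open>[]\<close>, while the double
    sum includes it; so this sum is treated separately, with any index set containing the
    statistics, here \<open>UNIV\<close>.\<close>
  have sB: "(partition_weight has_sum weight_sum ?B) ?B"
    unfolding weight_sum_def using pos(1)
    by (intro has_sum_gf(1)[where K = stats and c = monomial_xy and I = UNIV, OF _ partition_weight_eq _ refl]) auto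
  have sE: "(partition_weight has_sum weight_sum ?E) ?E"
    "((\<lambda>(i, j).
          fps_quot (var_x ^ (i + j) * var_y ^ j * var_q ^ (i^2 + j^2 + i + 2 * j))
                   (qpochhammer (var_q^2) (var_q^2) (i + j))
          * qbinomial (var_q^2) (int i - 1) (int j)) has_sum weight_sum ?E)
      {(i, j). i \<ge> 1 \<and> j \<ge> 0}"
    by (rule has_sum_partition_weight[OF pos(2) I(1) gfE]; assumption)+
  have sO: "(partition_weight has_sum weight_sum ?O) ?O"
    "((\<lambda>(i, j).
          fps_quot (var_x ^ (i + j) * var_y ^ j * var_q ^ (i^2 + j^2 + 3 * i))
                   (qpochhammer (var_q^2) (var_q^2) (i + j))
          * qbinomial (var_q^2) (int i - 1) (int j - 1)) has_sum weight_sum ?O)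
      {(i, j). i \<ge> 1 \<and> j \<ge> 0}"
    by (rule has_sum_partition_weight[OF pos(3) I(2) gfO]; assumption)+
  \<comment> \<open>The empty list accounts for the summand 1 in the first identity.\<close>
  have "weight_sum (insert [] ?B) = 1 + weight_sum ?B"
    using pos(1) by (intro weight_sum_insert_Nil) (auto simp: billiard_partitions_def)
  moreover have "((\<lambda>(i, j).
          fps_quot (var_x ^ (i + j) * var_y ^ j * var_q ^ (i^2 + j^2 + i + 2 * j))
                   (qpochhammer (var_q^2) (var_q^2) (i + j))
          * qbinomial (var_q^2) (int i) (int j)) has_sum weight_sum (insert [] ?B))
      {(i, j). i \<ge> 0 \<and> j \<ge> 0}"
    by (rule has_sum_partition_weight(2)[OF pos(1) _ gfB]) auto
  ultimately show ?thesis
    unfolding infsumI[OF sB] infsumI[OF sE(1)] infsumI[OF sO(1)]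
    using sE(2) sO(2) has_sum_imp_summable[OF sB] has_sum_imp_summable[OF sE(1)]
      has_sum_imp_summable[OF sO(1)] by (simp only: simp_thms)
qed

end
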